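(* Assume that $|\gamma_l(m)|<1$ for all $1\le m\le M$ and $1\le l\le d$. Let $\Phi=\{\phi_1,\ldots,\phi_r\}$ be a family of nonzero graph signals, and for $1\le m\le M$ let $$X(m)=\Big\{\big[\langle\widehat{\phi}_i(m),\widehat{\mathbf{x}}(m)\rangle\big]_{1\le i\le r}\ :\ \mathbf{x}\in\mathcal{S}(\Phi)\Big\}\subset\mathbb{R}^r.$$ Then there exists $\tilde\Phi=\{\tilde\phi_1,\ldots,\tilde\phi_r\}\subset\mathcal{S}(\Phi)$ that generates a shift-invariant dual frame if and only if the sum of the subspaces $X(m)$, $1\le m\le M$, is direct.
   Context: Let $\mathcal{G}=(V,E,\mathbf{W})$ be a finite, simple, undirected graph with $N\ge 2$ vertices. A graph signal is a vector in $\mathbb{R}^V$; $\langle\cdot,\cdot\rangle$ is the standard inner product on $\mathbb{R}^V$. A graph shift is a matrix $\mathbf{S}=[s(i,j)]_{i,j\in V}$ with $s(i,j)=0$ unless $i=j$ or $(i,j)\in E$. Standing assumption: $\mathbf{S}_1,\ldots,\mathbf{S}_d$ are graph shifts that are real-valued, symmetric and pairwise commuting. Choose an orthogonal matrix $\mathbf{U}=[\mathbf{u}_1,\ldots,\mathbf{u}_N]$ with $\mathbf{S}_l=\sum_{n=1}^N\lambda_l(n)\mathbf{u}_n\mathbf{u}_n^T$ for $1\le l\le d$, and set $\boldsymbol{\lambda}(n)=[\lambda_1(n),\ldots,\lambda_d(n)]^T\in\mathbb{R}^d$. Let $\boldsymbol{\gamma}(m)=[\gamma_1(m),\ldots,\gamma_d(m)]^T$,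 $1\le m\le M$, be the distinct elements of $\{\boldsymbol{\lambda}(n): 1\le n\le N\}$. Put $\mathbf{P}_m=\sum_{\boldsymbol{\lambda}(n)=\boldsymbol{\gamma}(m)}\mathbf{u}_n\mathbf{u}_n^T$ (independent of the choice of $\mathbf{U}$) and $\widehat{\mathbf{x}}(m)=\mathbf{P}_m\mathbf{x}$ for $\mathbf{x}\in\mathbb{R}^V$. For $\boldsymbol{\alpha}=(\alpha_1,\ldots,\alpha_d)\in\mathbb{Z}_+^d$ (nonnegative integers) write $\mathbf{S}^{\boldsymbol{\alpha}}=\mathbf{S}_1^{\alpha_1}\cdots\mathbf{S}_d^{\alpha_d}$. For a family $\Phi$ of graph signals, $\mathcal{S}(\Phi)=\mathrm{span}\{\mathbf{S}^{\boldsymbol{\alpha}}\phi : \boldsymbol{\alpha}\in\mathbb{Z}_+^d,\ \phi\in\Phi\}$. A family $\tilde\Phi=\{\tilde\phi_1,\ldots,\tilde\phi_r\}\subset\mathcal{S}(\Phi)$ is said to generate a shift-invariant dual frame (for $\mathcal{S}(\Phi)$) if $\mathbf{x}=\sum_{i=1}^r\sum_{\boldsymbol{\alpha}\in\mathbb{Z}_+^d}\langle\mathbf{x},\mathbf{S}^{\boldsymbol{\alpha}}\tilde\phi_i\rangle\,\mathbf{S}^{\boldsymbol{\alpha}}\phi_i$ for all $\mathbf{x}\in\mathcal{S}(\Phi)$. The sum of subspaces $X(1),\ldots,X(M)$ is direct if every element of $X(1)+\cdots+X(M)$ has a unique representation $\sum_{m=1}^M\mathbf{y}_m$ with $\mathbf{y}_m\in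 X(m)$. *)

theory Defs
  imports "HOL-Analysis.Analysis"
begin

text \<open>The vertex set of the graph is the whole finite type \<open>'v\<close>, so that
  graph signals are vectors of type \<open>real ^ 'v\<close> and the graph is given by its
  set of ordered pairs of adjacent vertices.\<close>

definition simple_graph :: "('v \<times> 'v) set \<Rightarrow> bool" where
  "simple_graph E \<longleftrightarrow> sym E \<and> irrefl E"

definition graph_shift :: "('v::finite \<times> 'v) set \<Rightarrow> real ^ 'v ^ 'v \<Rightarrow> bool" where
  "graph_shift E A \<longleftrightarrow> (\<forall>i j. A $ i $ j \<noteq> 0 \<longrightarrow> i = j \<or> (i, j) \<in> E)"

text \<open>Powers are iterated explicitly because \<open>*\<close> and \<open>^\<close> on \<open>real ^ 'v ^ 'v\<close> do not
  denote matrix multiplication.\<close>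

definition mat_power :: "real ^ 'v ^ 'v \<Rightarrow> nat \<Rightarrow> real ^ 'v ^ 'v" where
  "mat_power A k = (((**) A) ^^ k) (mat 1)"

text \<open>The ordered product \<open>S\<^sub>1 ^ \<alpha>\<^sub>1 ** \<dots> ** S\<^sub>d ^ \<alpha>\<^sub>d\<close>. The linear order on
  the index type \<open>'d\<close> plays the role of the order \<open>1 < \<dots> < d\<close>.\<close>

definition shift_power ::
  "('d::{finite,linorder} \<Rightarrow> real ^ 'v ^ 'v) \<Rightarrow> nat ^ ('d::{finite,linorder}) \<Rightarrow> real ^ 'v ^ 'v" where
  "shift_power S \<alpha> =
     foldr (**) (map (\<lambda>l. mat_power (S l) (\<alpha> $ l)) (sorted_list_of_set UNIV)) (mat 1)"

definition proj_onto :: "real ^ 'v \<Rightarrow> real ^ 'v ^ 'v" where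
  "proj_onto u = (columnvector u :: real ^ 1 ^ 'v) ** (rowvector u :: real ^ 'v ^ 1)"

text \<open>\<open>joint_diagonalization S U lam\<close> says that the columns \<open>u n\<close> of the orthogonal matrix \<open>U\<close>
  satisfy \<open>S l = (\<Sum>n. \<lambda>\<^sub>l(n) u n (u n)\<^sup>T)\<close>; the vector \<open>lam n\<close> is \<open>(\<lambda>\<^sub>1(n), \<dots>, \<lambda>\<^sub>d(n))\<close>.
  The columns of \<open>U\<close> are indexed by \<open>'v\<close>, which has the required number of elements.\<close>

definition joint_diagonalization ::
  "('d \<Rightarrow> real ^ 'v ^ 'v) \<Rightarrow> real ^ 'v ^ 'v \<Rightarrow> ('v \<Rightarrow> real ^ 'd) \<Rightarrow> bool" where
  "joint_diagonalization S U lam \<longleftrightarrow>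
     orthogonal_matrix U \<and>
     (\<forall>l. S l = (\<Sum>n\<in>UNIV. (lam n $ l) *\<^sub>R proj_onto (column n U)))"

definition spectral_proj ::
  "real ^ 'v ^ 'v \<Rightarrow> ('v \<Rightarrow> real ^ 'd) \<Rightarrow> real ^ 'd \<Rightarrow> real ^ 'v ^ 'v" where
  "spectral_proj U lam g = (\<Sum>n | lam n = g. proj_onto (column n U))"

definition shift_space ::
  "('d::{finite,linorder} \<Rightarrow> real ^ 'v ^ 'v) \<Rightarrow> ('r \<Rightarrow> real ^ 'v) \<Rightarrow> (real ^ 'v) set" where
  "shift_space S \<phi> = span {shift_power S \<alpha> *v \<phi> i | \<alpha> i. True}"

text \<open>Summability is required explicitly since \<open>infsum\<close> is \<open>0\<close> on non-summable families.\<close>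

definition generates_SI_dual_frame ::
  "('d::{finite,linorder} \<Rightarrow> real ^ 'v ^ 'v) \<Rightarrow> ('r::finite \<Rightarrow> real ^ 'v) \<Rightarrow> ('r \<Rightarrow> real ^ 'v) \<Rightarrow> bool" where
  "generates_SI_dual_frame S \<phi> \<psi> \<longleftrightarrow>
     (\<forall>i. \<psi> i \<in> shift_space S \<phi>) \<and>
     (\<forall>x \<in> shift_space S \<phi>.
        (\<forall>i. (\<lambda>\<alpha>. (x \<bullet> (shift_power S \<alpha> *v \<psi> i)) *\<^sub>R (shift_power S \<alpha> *v \<phi> i)) summable_on UNIV) \<and>
        x = (\<Sum>i\<in>UNIV. \<Sum>\<^sub>\<infinity>\<alpha>.
               (x \<bullet> (shift_power S \<alpha> *v \<psi> i)) *\<^sub>R (shift_power S \<alpha> *v \<phi> i)))"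

text \<open>The space \<open>X(m)\<close>; here \<open>P\<close> stands for the spectral projection \<open>P\<^sub>m\<close>.\<close>

definition frame_coeff_space ::
  "('d::{finite,linorder} \<Rightarrow> real ^ 'v ^ 'v) \<Rightarrow> ('r::finite \<Rightarrow> real ^ 'v) \<Rightarrow> real ^ 'v ^ 'v \<Rightarrow> (real ^ 'r) set" where
  "frame_coeff_space S \<phi> P =
     {\<chi> i. (P *v \<phi> i) \<bullet> (P *v x) | x. x \<in> shift_space S \<phi>}"

text \<open>Representations are extensional functions on the index set, so that uniqueness only concerns
  the summands with index in \<open>I\<close>.\<close>

definition sum_is_direct :: "'i set \<Rightarrow> ('i \<Rightarrow> 'a::comm_monoid_add set) \<Rightarrow> bool" where
  "sum_is_direct I X \<longleftrightarrow>
     (\<forall>z \<in> {\<Sum>m\<in>I. y m | y. \<forall>m\<in>I. y m \<in> X m}.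
        \<exists>!y. y \<in> Pi\<^sub>E I X \<and> z = (\<Sum>m\<in>I. y m))"

end

theory Submission
  imports Defs
begin

text \<open>
  On \<open>V = shift_space S \<phi>\<close> the joint spectral projections \<open>P m\<close> act, and
  \<open>S\<^sup>\<alpha> = (\<Sum>m. \<gamma>(m)\<^sup>\<alpha> P m)\<close>. Summing geometric series, with
  \<open>c(p, q) = (\<Prod>l. 1 / (1 - \<gamma>\<^sub>l(p) \<gamma>\<^sub>l(q))) \<noteq> 0\<close>, the dual frame identity becomes
  \<open>\<langle>x, z\<rangle> = (\<Sum>p q. c(p, q) (\<Sum>i. \<langle>P p x, \<psi> i\<rangle> \<langle>\<phi> i, P q z\<rangle>))\<close> for \<open>x, z \<in> V\<close>.
  Testing it on \<open>P p x\<close> and \<open>P q z\<close> shows that a vanishing sum of elements of the \<open>X(q)\<close> has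
  vanishing summands. Conversely, directness makes
  \<open>x \<mapsto> (\<Sum>m. c(m, m) [\<langle>\<phi> i, P m x\<rangle>]\<^sub>i)\<close> injective on \<open>V\<close>, and the images of the standard
  basis vectors of \<open>\<real>\<^sup>r\<close> under a linear left inverse into \<open>V\<close> form a dual frame generator.
\<close>

section \<open>Multivariate geometric series\<close>

definition vec_monomial :: "real ^ 'd \<Rightarrow> nat ^ 'd \<Rightarrow> real" where
  "vec_monomial t \<alpha> = (\<Prod>l\<in>UNIV. (t $ l) ^ (\<alpha> $ l))"

text \<open>The series over multi-indices factors into one geometric series per coordinate. The
  product rule for absolutely summable families is indexed by functions in \<open>PiE\<close>, hence
  the transport along \<open>vec_nth\<close>.\<close>

lemma has_sum_vec_monomial:
  fixes t :: "real ^ 'd"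
  assumes "\<And>l. \<bar>t $ l\<bar> < 1"
  shows "(vec_monomial t has_sum (\<Prod>l\<in>UNIV. 1 / (1 - t $ l))) UNIV"
proof -
  have geom: "((\<lambda>n. a ^ n) has_sum (1 / (1 - a))) (UNIV :: nat set)"
    and geom_abs: "(\<lambda>n. norm (a ^ n)) summable_on (UNIV :: nat set)" if "\<bar>a\<bar> < 1" for a :: real
  proof -
    have s: "summable (\<lambda>n. norm (a ^ n))"
      using that by (simp add: power_abs summable_geometric)
    show "((\<lambda>n. a ^ n) has_sum (1 / (1 - a))) (UNIV :: nat set)"
      using norm_summable_imp_has_sum[OF s geometric_sums] that by simp
    show "(\<lambda>n. norm (a ^ n)) summable_on (UNIV :: nat set)"
      using norm_summable_imp_has_sum[of "\<lambda>n. norm (a ^ n)" "\<Sum>n. norm (a ^ n)"] s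
      by (auto simp: summable_on_def intro: summable_sums)
  qed
  have bij: "bij_betw vec_nth (UNIV :: (nat ^ 'd) set) (PiE UNIV (\<lambda>_. UNIV))"
    by (rule bij_betwI[where g = vec_lambda]) (auto simp: vec_eq_iff)
  have inf: "infsum (vec_monomial b) UNIV = (\<Prod>l\<in>UNIV. 1 / (1 - b $ l))"
    if b: "\<And>l. \<bar>b $ l\<bar> < 1" for b :: "real ^ 'd"
  proof -
    have "infsum (vec_monomial b) UNIV =
        infsum (\<lambda>g. \<Prod>l\<in>UNIV. (b $ l) ^ (g l)) (PiE UNIV (\<lambda>_. UNIV))"
      using infsum_reindex_bij_betw[OF bij, of "\<lambda>g. \<Prod>l\<in>UNIV. (b $ l) ^ (g l)"]
      by (simp add: vec_monomial_def[abs_def])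
    also have "\<dots> = (\<Prod>l\<in>UNIV. infsum (\<lambda>n. (b $ l) ^ n) UNIV)"
      by (rule infsum_prod_PiE_abs) (use geom_abs b in auto)
    also have "\<dots> = (\<Prod>l\<in>UNIV. 1 / (1 - b $ l))"
      by (intro prod.cong refl infsumI geom b)
    finally show ?thesis .
  qed
  \<comment> \<open>Summability is extracted from the value: \<open>infsum\<close> of a non-summable
    family is 0, while the product formula at the vector of absolute values is nonzero. This gives
    absolute summability for \<open>t\<close>.\<close>
  define b :: "real ^ 'd" where "b = (\<chi> l. \<bar>t $ l\<bar>)"
  have b: "\<And>l. \<bar>b $ l\<bar> < 1" "\<And>l. b $ l < 1"
    using assms by (auto simp: b_def)
  have "infsum (vec_monomial b) UNIV \<noteq> 0"
    unfolding inf[OF b(1)] using b(2) by (simp add: less_imp_neq)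
  then have "vec_monomial b summable_on UNIV"
    using infsum_not_exists by blast
  moreover have "vec_monomial b = (\<lambda>\<alpha>. norm (vec_monomial t \<alpha>))"
    by (simp add: fun_eq_iff vec_monomial_def b_def abs_prod power_abs)
  ultimately have "vec_monomial t summable_on UNIV"
    using abs_summable_summable by metis
  then show ?thesis
    using inf[OF assms] by (metis has_sum_infsum)
qed

lemma has_sum_sum_family:
  fixes f :: "'i \<Rightarrow> 'a \<Rightarrow> 'b::topological_comm_monoid_add"
  assumes "\<And>i. i \<in> I \<Longrightarrow> (f i has_sum s i) A"
  shows "((\<lambda>a. \<Sum>i\<in>I. f i a) has_sum (\<Sum>i\<in>I. s i)) A"
  using assms
  by (induction I rule: infinite_finite_induct) (auto intro!: has_sum_add)

section \<open>Direct sums of subspaces\<close>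

lemma sum_is_direct_iff:
  fixes X :: "'i \<Rightarrow> 'a::real_vector set"
  assumes sub: "\<And>m. m \<in> I \<Longrightarrow> subspace (X m)"
  shows "sum_is_direct I X \<longleftrightarrow>
    (\<forall>y. (\<forall>m\<in>I. y m \<in> X m) \<and> (\<Sum>m\<in>I. y m) = 0 \<longrightarrow> (\<forall>m\<in>I. y m = 0))" (is "_ \<longleftrightarrow> ?R")
proof
  assume d: "sum_is_direct I X"
  show ?R
  proof (intro allI impI, elim conjE)
    fix y assume y: "\<forall>m\<in>I. y m \<in> X m" "(\<Sum>m\<in>I. y m) = 0"
    \<comment> \<open>Two representations of 0, restricted to \<open>I\<close> because
      \<open>Pi\<^sub>E\<close> demands extensional functions.\<close>
    let ?z = "restrict (\<lambda>_. 0) I" and ?y = "restrict y I"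
    have "0 \<in> {\<Sum>m\<in>I. y m | y. \<forall>m\<in>I. y m \<in> X m}"
      using y by force
    then have ex: "\<exists>!u. u \<in> Pi\<^sub>E I X \<and> 0 = (\<Sum>m\<in>I. u m)"
      using d unfolding sum_is_direct_def by blast
    have "?z \<in> Pi\<^sub>E I X \<and> 0 = (\<Sum>m\<in>I. ?z m)" "?y \<in> Pi\<^sub>E I X \<and> 0 = (\<Sum>m\<in>I. ?y m)"
      using y sub by (auto simp: subspace_0)
    with ex have "?z = ?y" by blast
    then show "\<forall>m\<in>I. y m = 0" by (metis restrict_apply')
  qed
next
  assume r: ?R
  show "sum_is_direct I X"
    unfolding sum_is_direct_def
  proof
    fix z assume "z \<in> {\<Sum>m\<in>I. y m | y. \<forall>m\<in>I. y m \<in> X m}"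
    then obtain y where y: "\<forall>m\<in>I. y m \<in> X m" "z = (\<Sum>m\<in>I. y m)" by blast
    show "\<exists>!y. y \<in> Pi\<^sub>E I X \<and> z = (\<Sum>m\<in>I. y m)"
    proof (rule ex1I[of _ "restrict y I"])
      show "restrict y I \<in> Pi\<^sub>E I X \<and> z = (\<Sum>m\<in>I. restrict y I m)"
        using y by auto
      fix u assume u: "u \<in> Pi\<^sub>E I X \<and> z = (\<Sum>m\<in>I. u m)"
      \<comment> \<open>The difference of two representations of \<open>z\<close> represents
        0.\<close>
      have "(\<forall>m\<in>I. u m - y m \<in> X m) \<and> (\<Sum>m\<in>I. u m - y m) = 0"
        using u y sub by (auto simp: sum_subtractf intro!: subspace_diff)
      with r[rule_format, of "\<lambda>m. u m - y m"] have "\<forall>m\<in>I. u m = y m" by auto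
      then have "restrict u I = restrict y I"
        by (intro restrict_ext) blast
      then show "u = restrict y I"
        using u by (metis PiE_restrict)
    qed
  qed
qed

section \<open>Matrices acting on vectors and on joint eigenvectors\<close>

lemma matrix_vector_mult_sum_left:
  fixes A :: "'i \<Rightarrow> real ^ 'n ^ 'm"
  shows "(\<Sum>i\<in>I. A i) *v x = (\<Sum>i\<in>I. A i *v x)"
  by (induction I rule: infinite_finite_induct) (auto simp: matrix_vector_mult_add_rdistrib)

lemma proj_onto_mult: "proj_onto u *v x = (u \<bullet> x) *\<^sub>R u"
  by (simp add: vec_eq_iff proj_onto_def matrix_matrix_mult_def matrix_vector_mult_def
      columnvector_def rowvector_def inner_vec_def sum_distrib_left mult_ac)

lemma mat_power_eigenvector:
  fixes A :: "real ^ 'v::finite ^ 'v"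
  assumes "A *v x = a *\<^sub>R x"
  shows "mat_power A k *v x = a ^ k *\<^sub>R x"
  by (induction k)
    (use assms in \<open>auto simp: mat_power_def matrix_vector_mul_assoc[symmetric]
       matrix_vector_mult_scaleR mult_ac\<close>)

lemma shift_power_eigenvector:
  fixes S :: "'d::{finite,linorder} \<Rightarrow> real ^ 'v::finite ^ 'v"
  assumes ev: "\<And>l. S l *v x = (t $ l) *\<^sub>R x"
  shows "shift_power S \<alpha> *v x = vec_monomial t \<alpha> *\<^sub>R x"
proof -
  \<comment> \<open>Generalised to an arbitrary list \<open>ls\<close> so that induction can unfold
    the \<open>foldr\<close>; the claim is the case of the sorted list of all indices.\<close>
  have "foldr (**) (map (\<lambda>l. mat_power (S l) (\<alpha> $ l)) ls) (mat 1) *v x =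
      prod_list (map (\<lambda>l. (t $ l) ^ (\<alpha> $ l)) ls) *\<^sub>R x" for ls
    by (induction ls)
      (auto simp: matrix_vector_mul_assoc[symmetric] matrix_vector_mult_scaleR
        mat_power_eigenvector[OF ev] mult_ac)
  then show ?thesis
    by (simp add: shift_power_def vec_monomial_def prod.distinct_set_conv_list[symmetric])
qed

section \<open>Joint spectral projections\<close>

locale spectral_decomposition =
  fixes S :: "'d::{finite,linorder} \<Rightarrow> real ^ 'v::finite ^ 'v"
    and U :: "real ^ 'v ^ 'v"
    and lam :: "'v \<Rightarrow> real ^ ('d::{finite,linorder})"
    and I :: "'i set"
    and \<gamma> :: "'i \<Rightarrow> real ^ ('d::{finite,linorder})"
  assumes diag: "joint_diagonalization S U lam"
    and bij: "bij_betw \<gamma> I (range lam)"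
begin

definition P :: "'i \<Rightarrow> real ^ 'v \<Rightarrow> real ^ 'v" where
  "P m x = spectral_proj U lam (\<gamma> m) *v x"

lemma finite_I: "finite I"
  using bij bij_betw_finite by fastforce

lemma inner_columns: "column i U \<bullet> column j U = (if i = j then 1 else 0)"
  using diag unfolding joint_diagonalization_def orthogonal_matrix_orthonormal_columns
  by (auto simp: orthogonal_def norm_eq_1)

lemma P_eq: "P m x = (\<Sum>n | lam n = \<gamma> m. (column n U \<bullet> x) *\<^sub>R column n U)"
  by (simp add: P_def spectral_proj_def matrix_vector_mult_sum_left proj_onto_mult)

lemma linear_P: "linear (P m)"
  unfolding P_def[abs_def] by (rule matrix_vector_mul_linear)

lemmas P_simps = linear_0[OF linear_P] linear_scale[OF linear_P]
  linear_diff[OF linear_P] linear_sum[OF linear_P]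

lemma P_sym: "P m x \<bullet> y = x \<bullet> P m y"
  by (simp add: P_eq inner_sum_left inner_sum_right inner_commute mult_ac)

text \<open>Orthonormality of the columns makes \<open>P m\<close> a 0/1 mask on coordinates; the
  rules \<open>P_P\<close> and \<open>shift_P\<close> are read off from this.\<close>

lemma column_inner_P: "column n U \<bullet> P m x = (if lam n = \<gamma> m then column n U \<bullet> x else 0)"
  by (simp add: P_eq inner_sum_right inner_columns if_distrib[of "\<lambda>c. _ * c"] cong: if_cong)

text \<open>\<open>\<gamma>\<close> is injective on \<open>I\<close>, so different indices select
  disjoint sets of columns.\<close>

lemma P_P: "p \<in> I \<Longrightarrow> q \<in> I \<Longrightarrow> P p (P q x) = (if p = q then P q x else 0)"
proof -
  assume "p \<in> I" "q \<in> I"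
  then have "\<gamma> p = \<gamma> q \<longleftrightarrow> p = q"
    using bij by (auto simp: bij_betw_def inj_on_def)
  then show ?thesis
    by (auto simp: P_eq[of p] column_inner_P intro!: sum.neutral) (auto simp: P_eq)
qed

lemma inner_P_P: "p \<in> I \<Longrightarrow> q \<in> I \<Longrightarrow> P p x \<bullet> P q y = (if p = q then x \<bullet> P p y else 0)"
  by (auto simp: P_sym[of p x] P_P)

text \<open>\<open>\<gamma>\<close> enumerates \<open>range lam\<close>, so the fibres of
  \<open>lam\<close> partition the columns and the sum is the expansion of \<open>x\<close> in an
  orthonormal basis.\<close>

lemma sum_P: "(\<Sum>m\<in>I. P m x) = x"
proof -
  have "(\<Sum>m\<in>I. P m x) = (\<Sum>g\<in>range lam. \<Sum>n | lam n = g. (column n U \<bullet> x) *\<^sub>R column n U)"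
    by (simp add: P_eq sum.reindex_bij_betw[OF bij, symmetric])
  also have "\<dots> = (\<Sum>n\<in>UNIV. (column n U \<bullet> x) *\<^sub>R column n U)"
    using sum.group[of UNIV "range lam" lam "\<lambda>n. (column n U \<bullet> x) *\<^sub>R column n U"] by simp
  also have "\<dots> = U *v (transpose U *v x)"
    by (simp add: vec_eq_iff matrix_vector_mult_def column_def transpose_def inner_vec_def
        sum_distrib_left mult_ac)
  also have "\<dots> = x"
    using diag unfolding joint_diagonalization_def orthogonal_matrix_def
    by (simp add: matrix_vector_mul_assoc del: transpose_matrix_vector)
  finally show ?thesis .
qed

lemma shift_P: "S l *v P m x = (\<gamma> m $ l) *\<^sub>R P m x"
proof -
  have "S l *v P m x = (\<Sum>n\<in>UNIV. if lam n = \<gamma> m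
      then (\<gamma> m $ l) *\<^sub>R (column n U \<bullet> x) *\<^sub>R column n U else 0)"
    using diag unfolding joint_diagonalization_def
    by (auto simp: matrix_vector_mult_sum_left scaleR_matrix_vector_assoc[symmetric]
        proj_onto_mult column_inner_P intro!: sum.cong)
  also have "\<dots> = (\<gamma> m $ l) *\<^sub>R P m x"
    by (simp add: P_eq scaleR_sum_right sum.If_cases)
  finally show ?thesis .
qed

lemma shift_power_P: "shift_power S \<alpha> *v P m x = vec_monomial (\<gamma> m) \<alpha> *\<^sub>R P m x"
  by (rule shift_power_eigenvector) (rule shift_P)

lemma matrix_mult_eq_sum_P: "A *v x = (\<Sum>m\<in>I. A *v P m x)" for A :: "real ^ 'v ^ 'v"
  by (simp add: sum_P flip: linear_sum[OF matrix_vector_mul_linear])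

lemma shift_power_eq: "shift_power S \<alpha> *v x = (\<Sum>m\<in>I. vec_monomial (\<gamma> m) \<alpha> *\<^sub>R P m x)"
  by (subst matrix_mult_eq_sum_P) (simp add: shift_power_P)

lemma P_shift: "m \<in> I \<Longrightarrow> P m (S l *v x) = (\<gamma> m $ l) *\<^sub>R P m x"
  by (subst matrix_mult_eq_sum_P)
    (simp add: shift_P P_simps P_P finite_I if_distrib[of "\<lambda>c. _ *\<^sub>R c"] cong: if_cong)

section \<open>The shift-invariant space and its spectral components\<close>

context
  fixes \<phi> :: "'r::finite \<Rightarrow> real ^ 'v"
begin

abbreviation "V \<equiv> shift_space S \<phi>"

lemma subspace_V: "subspace V"
  unfolding shift_space_def by (rule subspace_span)

lemma shift_in_V:
  assumes "x \<in> V" shows "S l *v x \<in> V"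
proof -
  have "S l *v (shift_power S \<alpha> *v y) \<in> V" if "y = \<phi> i" for \<alpha> y i
  proof -
    \<comment> \<open>The exponent of \<open>S l\<close> is raised by one. The matrix identity is
      checked on spectral components, where both sides act by scalars; this avoids reordering the
      product in \<open>shift_power\<close>.\<close>
    let ?\<beta> = "\<chi> k. \<alpha> $ k + (if k = l then 1 else 0)"
    have "vec_monomial t ?\<beta> = t $ l * vec_monomial t \<alpha>" for t :: "real ^ ('d::{finite,linorder})"
      by (simp add: vec_monomial_def power_add prod.distrib if_distrib[of "\<lambda>c. _ ^ c"] cong: if_cong)
    then have "S l *v (shift_power S \<alpha> *v y) = shift_power S ?\<beta> *v y"
      by (simp add: shift_power_eq linear_sum[OF matrix_vector_mul_linear]
          matrix_vector_mult_scaleR shift_P mult_ac)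
    then show ?thesis
      using that unfolding shift_space_def by (auto intro: span_base)
  qed
  moreover have "subspace {x. S l *v x \<in> V}"
    by (rule real_vector.linear_subspace_linear_preimage[OF matrix_vector_mul_linear subspace_V])
  ultimately show ?thesis
    using assms span_induct[of x "{shift_power S \<alpha> *v \<phi> i | \<alpha> i. True}" "\<lambda>x. S l *v x \<in> V"]
    unfolding shift_space_def by auto
qed

text \<open>The components with index in \<open>A\<close> are removed one at a time by Lagrange factors.\<close>

lemma annihilate_components:
  assumes "finite A" "A \<subseteq> I" "m \<in> I - A" "x \<in> V"
  shows "\<exists>y\<in>V. P m y = P m x \<and> (\<forall>q\<in>A. P q y = 0)"
  using assms
proof (induction A)
  case empty
  then show ?case by blast
next
  case (insert p A)
  then obtain y where y: "y \<in> V" "P m y = P m x" "\<forall>q\<in>A. P q y = 0" by auto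
  have "\<gamma> m \<noteq> \<gamma> p"
    using insert.prems bij by (auto simp: bij_betw_def inj_on_def)
  then obtain l where l: "\<gamma> m $ l \<noteq> \<gamma> p $ l" by (auto simp: vec_eq_iff)
  define z where "z = inverse (\<gamma> m $ l - \<gamma> p $ l) *\<^sub>R (S l *v y - (\<gamma> p $ l) *\<^sub>R y)"
  have Pz: "P q z = ((\<gamma> q $ l - \<gamma> p $ l) / (\<gamma> m $ l - \<gamma> p $ l)) *\<^sub>R P q y" if "q \<in> I" for q
    using that by (simp add: z_def P_simps P_shift divide_inverse mult_ac flip: scaleR_diff_left)
  have "z \<in> V"
    unfolding z_def using y(1) shift_in_V subspace_V
    by (intro subspace_scale subspace_diff) auto
  moreover have "P m z = P m x"
    using Pz[of m] l insert.prems y by simp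
  moreover have "\<forall>q\<in>insert p A. P q z = 0"
    using Pz insert.prems y by auto
  ultimately show ?case by blast
qed

text \<open>Removing all components other than \<open>m\<close> without leaving \<open>V\<close>
  produces an element \<open>y\<close> of \<open>V\<close> that equals its own component
  \<open>P m y\<close>.\<close>

lemma P_in_V:
  assumes "m \<in> I" "x \<in> V"
  shows "P m x \<in> V"
proof -
  obtain y where y: "y \<in> V" "P m y = P m x" "\<forall>q\<in>I - {m}. P q y = 0"
    using annihilate_components[of "I - {m}" m x] assms finite_I by auto
  have "y = P m y + (\<Sum>q\<in>I - {m}. P q y)"
    using sum_P[of y] assms(1) finite_I by (simp add: sum.remove)
  then show ?thesis using y by simp
qed

text \<open>The inner product of \<open>x\<close> with a generator of \<open>V\<close> is a
  combination of the numbers \<open>\<phi> i \<bullet> P m x\<close>, so \<open>x\<close> is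
  orthogonal to all of \<open>V\<close> and hence to itself.\<close>

lemma V_eq_0I:
  assumes x: "x \<in> V" and orth: "\<And>m i. m \<in> I \<Longrightarrow> \<phi> i \<bullet> P m x = 0"
  shows "x = 0"
proof -
  have "orthogonal x y" if "y \<in> {shift_power S \<alpha> *v \<phi> i | \<alpha> i. True}" for y
    using that orth
    by (auto simp: orthogonal_def shift_power_eq inner_sum_right inner_commute[of x] P_sym
        inner_sum_left)
  then have "orthogonal x x"
    using x orthogonal_to_span unfolding shift_space_def by blast
  then show ?thesis by (simp add: orthogonal_self)
qed

section \<open>The coefficient spaces\<close>

definition coeff :: "real ^ 'v \<Rightarrow> real ^ 'r" where
  "coeff x = (\<chi> i. \<phi> i \<bullet> x)"

lemma linear_coeff: "linear coeff"
  by (rule linearI) (simp_all add: coeff_def vec_eq_iff inner_add_right)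

lemma frame_coeff_space_eq:
  assumes "m \<in> I"
  shows "frame_coeff_space S \<phi> (spectral_proj U lam (\<gamma> m)) = (\<lambda>x. coeff (P m x)) ` V"
  using assms
  by (auto simp: frame_coeff_space_def coeff_def image_def P_P P_sym simp flip: P_def)

lemma subspace_frame_coeff_space:
  assumes "m \<in> I"
  shows "subspace (frame_coeff_space S \<phi> (spectral_proj U lam (\<gamma> m)))"
  unfolding frame_coeff_space_eq[OF assms]
  using linear_subspace_image[OF linear_compose[OF linear_P linear_coeff] subspace_V]
  by (simp add: o_def)

text \<open>Elements of the coefficient spaces are parametrised by signals in \<open>V\<close>,
  chosen independently for each index, so that directness becomes a statement about spectral
  components.\<close>

lemma direct_iff:
  "sum_is_direct I (\<lambda>m. frame_coeff_space S \<phi> (spectral_proj U lam (\<gamma> m))) \<longleftrightarrow>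
    (\<forall>x. (\<forall>m\<in>I. x m \<in> V) \<and> (\<Sum>m\<in>I. coeff (P m (x m))) = 0 \<longrightarrow> (\<forall>m\<in>I. coeff (P m (x m)) = 0))"
  (is "?D \<longleftrightarrow> ?R")
proof -
  have mem: "(\<forall>m\<in>I. y m \<in> frame_coeff_space S \<phi> (spectral_proj U lam (\<gamma> m))) \<longleftrightarrow>
      (\<forall>m\<in>I. y m \<in> (\<lambda>x. coeff (P m x)) ` V)" for y
    by (intro ball_cong refl) (simp only: frame_coeff_space_eq)
  have "?D \<longleftrightarrow> (\<forall>y. (\<forall>m\<in>I. y m \<in> (\<lambda>x. coeff (P m x)) ` V) \<and> (\<Sum>m\<in>I. y m) = 0 \<longrightarrow>
      (\<forall>m\<in>I. y m = 0))"
    by (subst sum_is_direct_iff) (simp_all only: mem subspace_frame_coeff_space)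
  also have "\<dots> \<longleftrightarrow> ?R"
  proof (intro iffI allI impI)
    fix x
    assume l: "\<forall>y. (\<forall>m\<in>I. y m \<in> (\<lambda>x. coeff (P m x)) ` V) \<and> (\<Sum>m\<in>I. y m) = 0 \<longrightarrow> (\<forall>m\<in>I. y m = 0)"
      and x: "(\<forall>m\<in>I. x m \<in> V) \<and> (\<Sum>m\<in>I. coeff (P m (x m))) = 0"
    show "\<forall>m\<in>I. coeff (P m (x m)) = 0"
      using l[rule_format, of "\<lambda>m. coeff (P m (x m))"] x by auto
  next
    fix y
    assume r: ?R and y: "(\<forall>m\<in>I. y m \<in> (\<lambda>x. coeff (P m x)) ` V) \<and> (\<Sum>m\<in>I. y m) = 0"
    from y have "\<forall>m\<in>I. \<exists>x. x \<in> V \<and> y m = coeff (P m x)" by blast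
    then obtain x where x: "\<And>m. m \<in> I \<Longrightarrow> x m \<in> V" "\<And>m. m \<in> I \<Longrightarrow> y m = coeff (P m (x m))"
      by metis
    have "(\<Sum>m\<in>I. coeff (P m (x m))) = 0"
      using y x(2) by (simp cong: sum.cong)
    then have "\<forall>m\<in>I. coeff (P m (x m)) = 0" using r x(1) by blast
    then show "\<forall>m\<in>I. y m = 0" using x(2) by simp
  qed
  finally show ?thesis .
qed

section \<open>The dual frame series and its bilinear form\<close>

context
  assumes bound: "\<And>m l. m \<in> I \<Longrightarrow> \<bar>\<gamma> m $ l\<bar> < 1"
begin

definition c :: "'i \<Rightarrow> 'i \<Rightarrow> real" where
  "c p q = (\<Prod>l\<in>UNIV. 1 / (1 - \<gamma> p $ l * \<gamma> q $ l))"

lemma abs_mult_less_1: "p \<in> I \<Longrightarrow> q \<in> I \<Longrightarrow> \<bar>\<gamma> p $ l * \<gamma> q $ l\<bar> < 1"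
  using bound[of p l] bound[of q l] mult_strict_mono'[of "\<bar>\<gamma> p $ l\<bar>" 1 "\<bar>\<gamma> q $ l\<bar>" 1]
  by (simp add: abs_mult)

text \<open>As 1 / 0 = 0 in HOL, a factor of the product vanishes exactly when
  \<open>\<gamma> p $ l * \<gamma> q $ l\<close> is 1, which \<open>abs_mult_less_1\<close>
  excludes.\<close>

lemma c_nonzero: "p \<in> I \<Longrightarrow> q \<in> I \<Longrightarrow> c p q \<noteq> 0"
  using abs_mult_less_1[of p q] by (auto simp: c_def) (metis abs_one less_irrefl)

lemma c_has_sum:
  assumes "p \<in> I" "q \<in> I"
  shows "((\<lambda>\<alpha>. vec_monomial (\<gamma> p) \<alpha> * vec_monomial (\<gamma> q) \<alpha>) has_sum c p q) UNIV"
proof -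
  have "(\<lambda>\<alpha>. vec_monomial (\<gamma> p) \<alpha> * vec_monomial (\<gamma> q) \<alpha>) = vec_monomial (\<chi> l. \<gamma> p $ l * \<gamma> q $ l)"
    by (simp add: fun_eq_iff vec_monomial_def power_mult_distrib prod.distrib)
  then show ?thesis
    using has_sum_vec_monomial[of "\<chi> l. \<gamma> p $ l * \<gamma> q $ l"] abs_mult_less_1 assms
    by (simp add: c_def)
qed

text \<open>After both factors are expanded into spectral components, \<alpha> occurs only in
  products of two monomials, and \<open>c_has_sum\<close> handles each term of the finite double
  sum.\<close>

lemma frame_has_sum:
  "((\<lambda>\<alpha>. (x \<bullet> (shift_power S \<alpha> *v u)) *\<^sub>R (shift_power S \<alpha> *v v)) has_sum
    (\<Sum>p\<in>I. \<Sum>q\<in>I. (c p q * (P p x \<bullet> u)) *\<^sub>R P q v)) UNIV"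
proof -
  have "x \<bullet> (shift_power S \<alpha> *v u) = (\<Sum>p\<in>I. vec_monomial (\<gamma> p) \<alpha> * (P p x \<bullet> u))" for \<alpha>
    by (simp add: shift_power_eq inner_sum_right P_sym)
  then have "(\<lambda>\<alpha>. (x \<bullet> (shift_power S \<alpha> *v u)) *\<^sub>R (shift_power S \<alpha> *v v)) =
      (\<lambda>\<alpha>. \<Sum>p\<in>I. \<Sum>q\<in>I. (vec_monomial (\<gamma> p) \<alpha> * vec_monomial (\<gamma> q) \<alpha>) *\<^sub>R (P p x \<bullet> u) *\<^sub>R P q v)"
    by (simp add: fun_eq_iff shift_power_eq[of _ v] scaleR_sum_left)
      (simp add: scaleR_sum_right mult_ac)
  moreover have "((\<lambda>\<alpha>. (vec_monomial (\<gamma> p) \<alpha> * vec_monomial (\<gamma> q) \<alpha>) *\<^sub>R (P p x \<bullet> u) *\<^sub>R P q v)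
      has_sum (c p q *\<^sub>R (P p x \<bullet> u) *\<^sub>R P q v)) UNIV" if "p \<in> I" "q \<in> I" for p q
    using has_sum_bounded_linear[OF bounded_linear_scaleR_left c_has_sum[OF that]] .
  ultimately show ?thesis
    by (simp add: has_sum_sum_family)
qed

definition frame_form :: "('r \<Rightarrow> real ^ 'v) \<Rightarrow> real ^ 'v \<Rightarrow> real ^ 'v \<Rightarrow> real" where
  "frame_form \<psi> x z = (\<Sum>p\<in>I. \<Sum>q\<in>I. c p q * (\<Sum>i\<in>UNIV. (P p x \<bullet> \<psi> i) * (\<phi> i \<bullet> P q z)))"

text \<open>The reconstruction \<open>F x\<close> lies in \<open>V\<close> because \<open>V\<close>
  is closed under the projections, so \<open>x = F x\<close> can be tested by inner products with
  elements of \<open>V\<close>.\<close>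

lemma generates_iff:
  "generates_SI_dual_frame S \<phi> \<psi> \<longleftrightarrow>
    (\<forall>i. \<psi> i \<in> V) \<and> (\<forall>x\<in>V. \<forall>z\<in>V. x \<bullet> z = frame_form \<psi> x z)"
proof -
  define F where "F x = (\<Sum>i\<in>UNIV. \<Sum>p\<in>I. \<Sum>q\<in>I. (c p q * (P p x \<bullet> \<psi> i)) *\<^sub>R P q (\<phi> i))" for x
  have gen: "generates_SI_dual_frame S \<phi> \<psi> \<longleftrightarrow> (\<forall>i. \<psi> i \<in> V) \<and> (\<forall>x\<in>V. x = F x)"
    unfolding generates_SI_dual_frame_def F_def
    by (simp add: infsumI[OF frame_has_sum] has_sum_imp_summable[OF frame_has_sum])
  have "F x \<bullet> z = (\<Sum>i\<in>UNIV. \<Sum>p\<in>I. \<Sum>q\<in>I. c p q * ((P p x \<bullet> \<psi> i) * (\<phi> i \<bullet> P q z)))" for x z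
    by (simp add: F_def inner_sum_left P_sym mult_ac)
  then have inner_F: "F x \<bullet> z = frame_form \<psi> x z" for x z
    unfolding frame_form_def sum_distrib_left
    by (simp add: sum.swap[of _ I UNIV])
  have base: "\<phi> i \<in> V" for i
  proof -
    have "vec_monomial t 0 = 1" for t :: "real ^ ('d::{finite,linorder})"
      by (simp add: vec_monomial_def)
    then have "\<phi> i = shift_power S 0 *v \<phi> i"
      by (simp add: shift_power_eq sum_P)
    then show ?thesis unfolding shift_space_def by (auto intro: span_base)
  qed
  have F_in: "F x \<in> V" for x
    unfolding F_def
    by (intro subspace_sum[OF subspace_V] subspace_scale[OF subspace_V] P_in_V base)
  have "x = F x \<longleftrightarrow> (\<forall>z\<in>V. x \<bullet> z = frame_form \<psi> x z)" if "x \<in> V" for x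
  proof
    assume "\<forall>z\<in>V. x \<bullet> z = frame_form \<psi> x z"
    \<comment> \<open>The decisive test signal is \<open>x - F x\<close> itself.\<close>
    moreover have "x - F x \<in> V"
      using that F_in subspace_V by (intro subspace_diff)
    ultimately have "(x - F x) \<bullet> (x - F x) = 0"
      by (metis inner_F inner_diff_left right_minus_eq)
    then show "x = F x" by simp
  qed (use inner_F in metis)
  then show ?thesis unfolding gen by blast
qed

section \<open>Duality versus directness\<close>

lemma frame_form_components:
  assumes "p \<in> I" "q \<in> I"
  shows "frame_form \<psi> (P p x) (P q z) =
    c p q * (\<Sum>i\<in>UNIV. (P p x \<bullet> \<psi> i) * (\<phi> i \<bullet> P q z))"
proof -
  have "frame_form \<psi> (P p x) (P q z) =
      (\<Sum>p'\<in>I. if p = p' then \<Sum>q'\<in>I. if q = q' then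
        c p q * (\<Sum>i\<in>UNIV. (P p x \<bullet> \<psi> i) * (\<phi> i \<bullet> P q z)) else 0 else 0)"
    unfolding frame_form_def using assms by (intro sum.cong refl) (auto simp: P_P intro!: sum.cong)
  then show ?thesis using assms finite_I by simp
qed

lemma direct_if_dual:
  assumes "generates_SI_dual_frame S \<phi> \<psi>"
  shows "sum_is_direct I (\<lambda>m. frame_coeff_space S \<phi> (spectral_proj U lam (\<gamma> m)))"
  unfolding direct_iff
proof (intro allI impI ballI, elim conjE)
  fix x p
  assume x: "\<forall>m\<in>I. x m \<in> V" and s: "(\<Sum>m\<in>I. coeff (P m (x m))) = 0" and p: "p \<in> I"
  \<comment> \<open>\<open>y\<close> is the component to be shown zero; pairing the vanishing
    coefficient sum with the numbers \<open>y \<bullet> \<psi> i\<close> will isolate it.\<close>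
  define y where "y = P p (x p)"
  have y: "y \<in> V" using x p P_in_V by (simp add: y_def)
  \<comment> \<open>The dual frame identity is evaluated at \<open>y\<close> and
    \<open>P q (x q)\<close>. Its left side vanishes for \<open>q \<noteq> p\<close> because
    components are orthogonal, and the nonzero \<open>c p q\<close> is divided out.\<close>
  have key: "(\<Sum>i\<in>UNIV. (y \<bullet> \<psi> i) * (\<phi> i \<bullet> P q (x q))) = (if q = p then (y \<bullet> y) / c p p else 0)"
    if q: "q \<in> I" for q
  proof -
    have "y \<bullet> P q (x q) = c p q * (\<Sum>i\<in>UNIV. (y \<bullet> \<psi> i) * (\<phi> i \<bullet> P q (x q)))"
    proof -
      have "y \<bullet> P q (x q) = frame_form \<psi> y (P q (x q))"
        using assms y P_in_V[OF q] x q unfolding generates_iff by blast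
      then show ?thesis
        using frame_form_components[OF p q, of \<psi> "x p" "x q"] by (simp only: y_def)
    qed
    moreover have "y \<bullet> P q (x q) = (if q = p then y \<bullet> y else 0)"
      unfolding y_def using p q by (auto simp: inner_P_P)
    ultimately show ?thesis
      using c_nonzero[OF p q] by (auto simp: field_simps)
  qed
  have "(\<Sum>q\<in>I. \<phi> i \<bullet> P q (x q)) = 0" for i
    using arg_cong[OF s, of "\<lambda>v. v $ i"] by (simp add: coeff_def)
  then have "0 = (\<Sum>i\<in>UNIV. (y \<bullet> \<psi> i) * (\<Sum>q\<in>I. \<phi> i \<bullet> P q (x q)))"
    by simp
  also have "\<dots> = (\<Sum>q\<in>I. \<Sum>i\<in>UNIV. (y \<bullet> \<psi> i) * (\<phi> i \<bullet> P q (x q)))"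
    unfolding sum_distrib_left by (rule sum.swap)
  also have "\<dots> = (y \<bullet> y) / c p p"
    using p finite_I by (simp add: key)
  finally have "y = 0"
    using c_nonzero[OF p p] by simp
  then show "coeff (P p (x p)) = 0"
    unfolding y_def by (simp add: linear_0[OF linear_coeff])
qed

lemma dual_if_direct:
  assumes dir: "sum_is_direct I (\<lambda>m. frame_coeff_space S \<phi> (spectral_proj U lam (\<gamma> m)))"
  shows "\<exists>\<psi>. generates_SI_dual_frame S \<phi> \<psi>"
proof -
  \<comment> \<open>The weights are chosen so that a left inverse of \<open>G\<close> sends the
    coefficients of \<open>P q z\<close> to \<open>P q z\<close> divided by \<open>c q q\<close>,
    cancelling the diagonal factor in \<open>frame_form\<close>.\<close>
  define G where "G x = (\<Sum>m\<in>I. coeff (P m (c m m *\<^sub>R x)))" for x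
  have lin_G: "linear G"
    unfolding G_def[abs_def]
    by (intro linear_compose_sum ballI linear_compose[unfolded o_def, OF _ linear_coeff]
        linear_compose[unfolded o_def, OF _ linear_P] linear_compose_scale_right linear_ident)
  have "x = 0" if x: "x \<in> V" "G x = 0" for x
  proof (rule V_eq_0I[OF x(1)])
    fix m i assume m: "m \<in> I"
    \<comment> \<open>Directness is applied to multiples of one signal \<open>x\<close>; the nonzero
      weights then drop out.\<close>
    have "(\<forall>m\<in>I. c m m *\<^sub>R x \<in> V) \<and> (\<Sum>m\<in>I. coeff (P m (c m m *\<^sub>R x))) = 0"
      using x subspace_V by (auto simp: G_def intro!: subspace_scale)
    then have "coeff (P m (c m m *\<^sub>R x)) = 0"
      using dir[unfolded direct_iff, rule_format, of "\<lambda>m. c m m *\<^sub>R x"] m by blast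
    then show "\<phi> i \<bullet> P m x = 0"
      using c_nonzero[OF m m] by (auto simp: coeff_def vec_eq_iff P_simps)
  qed
  then have "inj_on G V"
    using linear_injective_on_subspace_0[OF lin_G subspace_V] by blast
  \<comment> \<open>The left inverse takes values in \<open>V\<close>, which puts every
    \<open>\<psi> i\<close> into \<open>V\<close>.\<close>
  then obtain L where L: "L ` UNIV \<subseteq> V" "linear L" "\<forall>x\<in>V. L (G x) = x"
    using linear_exists_left_inverse_on[OF lin_G subspace_V] by auto
  define \<psi> where "\<psi> i = L (axis i 1)" for i
  have L_coeff: "L (coeff (P q z)) = inverse (c q q) *\<^sub>R P q z" if "q \<in> I" "z \<in> V" for q z
  proof -
    have "G (P q z) = (\<Sum>m\<in>I. if m = q then c q q *\<^sub>R coeff (P q z) else 0)"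
      unfolding G_def using that
      by (intro sum.cong) (auto simp: P_simps P_P linear_0[OF linear_coeff] linear_scale[OF linear_coeff])
    also have "\<dots> = c q q *\<^sub>R coeff (P q z)"
      using that finite_I by simp
    finally have "c q q *\<^sub>R L (coeff (P q z)) = P q z"
      using L(3) P_in_V that by (metis linear_scale[OF L(2)])
    then show ?thesis
      using c_nonzero that by (metis scaleR_scaleR left_inverse scaleR_one)
  qed
  \<comment> \<open>The \<open>\<psi> i\<close> are the images of the standard basis under
    \<open>L\<close>, so by linearity a combination of them with coefficients \<open>v\<close> is
    \<open>L v\<close>.\<close>
  have inner_L: "(\<Sum>i\<in>UNIV. (w \<bullet> \<psi> i) * v $ i) = w \<bullet> L v" for w :: "real ^ 'v" and v :: "real ^ 'r"
  proof -
    have "L v = L (\<Sum>i\<in>UNIV. v $ i *\<^sub>R axis i 1)"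
      by (simp add: basis_expansion flip: scalar_mult_eq_scaleR)
    also have "\<dots> = (\<Sum>i\<in>UNIV. v $ i *\<^sub>R \<psi> i)"
      by (simp add: linear_sum[OF L(2)] linear_scale[OF L(2)] \<psi>_def)
    finally show ?thesis by (simp add: inner_sum_right mult_ac)
  qed
  have "frame_form \<psi> x z = x \<bullet> z" if "x \<in> V" "z \<in> V" for x z
  proof -
    have "(\<Sum>i\<in>UNIV. (P p x \<bullet> \<psi> i) * (\<phi> i \<bullet> P q z)) = P p x \<bullet> (inverse (c q q) *\<^sub>R P q z)"
      if "p \<in> I" "q \<in> I" for p q
      using inner_L[of "P p x" "coeff (P q z)"] L_coeff[OF that(2) \<open>z \<in> V\<close>]
      by (simp add: coeff_def)
    \<comment> \<open>Off-diagonal terms vanish by orthogonality of components, whatever the value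
      of \<open>c p q\<close>; on the diagonal \<open>c p p\<close> cancels its inverse.\<close>
    then have "frame_form \<psi> x z = (\<Sum>p\<in>I. \<Sum>q\<in>I. if p = q then x \<bullet> P p z else 0)"
      unfolding frame_form_def
      by (intro sum.cong refl) (auto simp: inner_P_P c_nonzero)
    also have "\<dots> = x \<bullet> (\<Sum>p\<in>I. P p z)"
      using finite_I by (simp add: inner_sum_right)
    finally show ?thesis by (simp add: sum_P)
  qed
  then have "generates_SI_dual_frame S \<phi> \<psi>"
    unfolding generates_iff \<psi>_def using L(1) by auto
  then show ?thesis by blast
qed

end

end

end

theorem theorem4p10:
  fixes E :: "('v::finite \<times> 'v) set"
    and S :: "'d::{finite,linorder} \<Rightarrow> real ^ 'v ^ 'v"
    and U :: "real ^ 'v ^ 'v"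
    and lam :: "'v \<Rightarrow> real ^ ('d::{finite,linorder})"
    and M :: nat
    and \<gamma> :: "nat \<Rightarrow> real ^ ('d::{finite,linorder})"
    and \<phi> :: "'r::finite \<Rightarrow> real ^ 'v"
  assumes "CARD('v) \<ge> 2"
    and "simple_graph E"
    and "\<And>l. graph_shift E (S l)"
    and "\<And>l. transpose (S l) = S l"
    and "\<And>k l. S k ** S l = S l ** S k"
    and "joint_diagonalization S U lam"
    and "bij_betw \<gamma> {1..M} (range lam)"
    and "\<And>m l. m \<in> {1..M} \<Longrightarrow> \<bar>\<gamma> m $ l\<bar> < 1"
    and "\<And>i. \<phi> i \<noteq> 0"
  shows "(\<exists>\<psi>. generates_SI_dual_frame S \<phi> \<psi>) \<longleftrightarrow>
         sum_is_direct {1..M} (\<lambda>m. frame_coeff_space S \<phi> (spectral_proj U lam (\<gamma> m)))"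
proof -
  interpret spectral_decomposition S U lam "{1..M}" \<gamma>
    by unfold_locales (fact assms)+
  show ?thesis
    using direct_if_dual[of \<phi>] dual_if_direct[of \<phi>] assms(8) by blast
qed

end
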